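(* Let $n,T\ge1$ and $0\le K<T$ be integers, and let real numbers $r_{jt}$ ($j=1,\ldots,n$, $t=1,\ldots,T$) and $\mu_0$ be given. Let $\alpha\ge 0$ be large enough that $a_{jt}:=\frac{1}{T-K}(r_{jt}+\alpha)>0$ for all $j,t$ and $\beta:=\mu_0+\alpha>0$. If $S\subseteq\{1,\ldots,T\}$ is a critical set, then the inequalities $$\sum_{t\in S}\tilde{x}_{jt}\le T-K-1,\qquad j=1,\ldots,n,$$ are valid for the Scenario Filtering MIQP model, i.e. they are satisfied by every feasible solution $(x,\tilde x,z,d)$ of that model.
   Context: A set $S\subseteq\{1,\ldots,T\}$ is called critical if for every $R\subseteq S$ with $|R|=T-K$ one has $\sum_{t\in R}\sum_{j=1}^n a_{jt}<\beta$. The Scenario Filtering MIQP (mixed integer quadratic programming) model, with $q_t=\frac{1}{T-K}$, has variables $x_j$, $\tilde x_{jt}$, $z_t$, $d_t$ ($j=1,\ldots,n$, $t=1,\ldots,T$) and reads: minimize $\sum_{t=1}^T q_t d_t^2$ subject to - $d_{t'}\ge\sum_{j=1}^n r_{jt'}x_j-\sum_{t=1}^T\sum_{j=1}^n q_t r_{jt}\tilde x_{jt}-z_{t'}M_{t'}^{+}$ for $t'=1,\ldots,T$; - $d_{t'}\ge-\sum_{j=1}^n r_{jt'}x_j+\sum_{t=1}^T\sum_{j=1}^n q_t r_{jt}\tilde x_{jt}-z_{t'}M_{t'}^{-}$ for $t'=1,\ldots,T$; - $\sum_{j=1}^n\tilde x_{jt}=1-z_t$ for $t=1,\ldots,T$;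 - $\tilde x_{jt}\le x_j$ for $j=1,\ldots,n$, $t=1,\ldots,T$; - $\sum_{t=1}^T\sum_{j=1}^n q_t r_{jt}\tilde x_{jt}\ge\mu_0$; - $\sum_{j=1}^n x_j=1$ and $\sum_{t=1}^T z_t=K$; - $x_j\ge0$, $z_t\in\{0,1\}$, $d_t\ge0$, $\tilde x_{jt}\ge0$ for all $j,t$. Here $M_t^{+},M_t^{-}>0$ are constants chosen big enough (so that the first two families of constraints impose nothing beyond $d_{t'}\ge0$ when $z_{t'}=1$). *)

theory Defs
  imports Complex_Main
begin

text \<open>
  Assets are indexed by \<open>j \<in> {1..n}\<close> and scenarios by \<open>t \<in> {1..T}\<close>; values of the functions
  outside these ranges are irrelevant. Throughout, \<open>K < T\<close> is intended, so that the
  truncated difference \<open>T - K\<close> is the actual one.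
\<close>

definition critical :: "nat \<Rightarrow> nat \<Rightarrow> nat \<Rightarrow> (nat \<Rightarrow> nat \<Rightarrow> real) \<Rightarrow> real \<Rightarrow> nat set \<Rightarrow> bool" where
  "critical n T K a \<beta> S \<longleftrightarrow>
     S \<subseteq> {1..T} \<and>
     (\<forall>R. R \<subseteq> S \<and> card R = T - K \<longrightarrow> (\<Sum>t\<in>R. \<Sum>j=1..n. a j t) < \<beta>)"

definition sf_weight :: "nat \<Rightarrow> nat \<Rightarrow> nat \<Rightarrow> real" where
  "sf_weight T K t = 1 / real (T - K)"

definition sf_mean ::
  "nat \<Rightarrow> nat \<Rightarrow> nat \<Rightarrow> (nat \<Rightarrow> nat \<Rightarrow> real) \<Rightarrow> (nat \<Rightarrow> nat \<Rightarrow> real) \<Rightarrow> real" where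
  "sf_mean n T K r xt = (\<Sum>t=1..T. \<Sum>j=1..n. sf_weight T K t * r j t * xt j t)"

text \<open>The constraints that involve neither \<open>d\<close> nor the big-M constants.\<close>

definition sf_selection ::
  "nat \<Rightarrow> nat \<Rightarrow> nat \<Rightarrow> (nat \<Rightarrow> nat \<Rightarrow> real) \<Rightarrow> real \<Rightarrow>
   (nat \<Rightarrow> real) \<Rightarrow> (nat \<Rightarrow> nat \<Rightarrow> real) \<Rightarrow> (nat \<Rightarrow> real) \<Rightarrow> bool" where
  "sf_selection n T K r \<mu>0 x xt z \<longleftrightarrow>
     (\<forall>t\<in>{1..T}. (\<Sum>j=1..n. xt j t) = 1 - z t) \<and>
     (\<forall>j\<in>{1..n}. \<forall>t\<in>{1..T}. xt j t \<le> x j) \<and>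
     sf_mean n T K r xt \<ge> \<mu>0 \<and>
     (\<Sum>j=1..n. x j) = 1 \<and>
     (\<Sum>t=1..T. z t) = real K \<and>
     (\<forall>j\<in>{1..n}. x j \<ge> 0) \<and>
     (\<forall>t\<in>{1..T}. z t \<in> {0, 1}) \<and>
     (\<forall>j\<in>{1..n}. \<forall>t\<in>{1..T}. xt j t \<ge> 0)"

text \<open>
  The feasible region of the model. The objective \<open>\<Sum>t=1..T. sf_weight T K t * (d t)\<^sup>2\<close> does not
  restrict it.
\<close>

definition sf_feasible ::
  "nat \<Rightarrow> nat \<Rightarrow> nat \<Rightarrow> (nat \<Rightarrow> nat \<Rightarrow> real) \<Rightarrow> real \<Rightarrow> (nat \<Rightarrow> real) \<Rightarrow> (nat \<Rightarrow> real) \<Rightarrow>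
   (nat \<Rightarrow> real) \<Rightarrow> (nat \<Rightarrow> nat \<Rightarrow> real) \<Rightarrow> (nat \<Rightarrow> real) \<Rightarrow> (nat \<Rightarrow> real) \<Rightarrow> bool" where
  "sf_feasible n T K r \<mu>0 Mp Mm x xt z d \<longleftrightarrow>
     (\<forall>t\<in>{1..T}. d t \<ge> (\<Sum>j=1..n. r j t * x j) - sf_mean n T K r xt - z t * Mp t) \<and>
     (\<forall>t\<in>{1..T}. d t \<ge> - (\<Sum>j=1..n. r j t * x j) + sf_mean n T K r xt - z t * Mm t) \<and>
     sf_selection n T K r \<mu>0 x xt z \<and>
     (\<forall>t\<in>{1..T}. d t \<ge> 0)"

text \<open>
  The big-M constants are large enough when, for every filtered-out scenario (\<open>z t = 1\<close>), both
  lower bounds on \<open>d t\<close> are nonpositive and hence implied by \<open>d t \<ge> 0\<close>.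
\<close>

definition sf_big_M ::
  "nat \<Rightarrow> nat \<Rightarrow> nat \<Rightarrow> (nat \<Rightarrow> nat \<Rightarrow> real) \<Rightarrow> real \<Rightarrow> (nat \<Rightarrow> real) \<Rightarrow> (nat \<Rightarrow> real) \<Rightarrow> bool" where
  "sf_big_M n T K r \<mu>0 Mp Mm \<longleftrightarrow>
     (\<forall>t\<in>{1..T}. Mp t > 0 \<and> Mm t > 0) \<and>
     (\<forall>x xt z. sf_selection n T K r \<mu>0 x xt z \<longrightarrow>
        (\<forall>t\<in>{1..T}. z t = 1 \<longrightarrow>
           (\<Sum>j=1..n. r j t * x j) - sf_mean n T K r xt - z t * Mp t \<le> 0 \<and>
           - (\<Sum>j=1..n. r j t * x j) + sf_mean n T K r xt - z t * Mm t \<le> 0))"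

end

theory Submission
  imports Defs
begin

text \<open>
  Each \<open>xt j t\<close> lies in \<open>[0, 1]\<close> and vanishes unless \<open>t\<close> belongs to the set \<open>P\<close> of selected
  scenarios, which has \<open>T - K\<close> elements. Shifting the returns by \<open>\<alpha>\<close> turns the return constraint
  into \<open>\<beta> \<le> (\<Sum>t\<in>P. \<Sum>j=1..n. a j t * xt j t)\<close>, so the full sum of \<open>a\<close> over \<open>P\<close> is at least \<open>\<beta>\<close>.
  A critical set \<open>S\<close> therefore cannot contain \<open>P\<close>; it misses an element of \<open>P\<close>, and the sum of
  \<open>xt j t\<close> over \<open>S\<close> has at most \<open>T - K - 1\<close> nonzero terms.
\<close>

lemma sf_selection_le_one:
  assumes sel: "sf_selection n T K r \<mu>0 x xt z" and j: "j \<in> {1..n}" and t: "t \<in> {1..T}"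
  shows "xt j t \<le> 1"
proof -
  have "x j \<le> (\<Sum>i=1..n. x i)"
    using sel j by (intro member_le_sum) (auto simp: sf_selection_def)
  also have "\<dots> = 1"
    using sel by (simp add: sf_selection_def)
  finally have "x j \<le> 1" .
  moreover have "xt j t \<le> x j"
    using sel j t by (simp add: sf_selection_def)
  ultimately show ?thesis
    by linarith
qed

text \<open>Since \<open>z t\<close> is binary, \<open>z t \<noteq> 0\<close> means
  \<open>z t = 1\<close>, so the nonnegative entries \<open>xt i t\<close> sum to 0 and each one
  vanishes.\<close>

lemma sf_selection_eq_zero:
  assumes sel: "sf_selection n T K r \<mu>0 x xt z"
    and j: "j \<in> {1..n}" and t: "t \<in> {1..T}" and z: "z t \<noteq> 0"
  shows "xt j t = 0"
proof -
  have "(\<Sum>i=1..n. xt i t) = 0"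
    using sel t z by (auto simp: sf_selection_def)
  moreover have "\<forall>i\<in>{1..n}. 0 \<le> xt i t"
    using sel t by (simp add: sf_selection_def)
  ultimately show ?thesis
    using j sum_nonneg_eq_0_iff[of "{1..n}" "\<lambda>i. xt i t"] by auto
qed

text \<open>For binary \<open>z\<close>, the number \<open>1 - z t\<close> is the indicator of
  \<open>z t = 0\<close>; summing it counts the selected scenarios.\<close>

lemma sf_selection_card:
  assumes sel: "sf_selection n T K r \<mu>0 x xt z"
  shows "real (card {t \<in> {1..T}. z t = 0}) = real T - real K"
proof -
  have "1 - z t = (if z t = 0 then 1 else 0)" if "t \<in> {1..T}" for t
    using sel that by (auto simp: sf_selection_def)
  then have "(\<Sum>t=1..T. 1 - z t) = (\<Sum>t=1..T. if z t = 0 then 1 else 0)"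
    by (intro sum.cong) auto
  also have "\<dots> = real (card {t \<in> {1..T}. z t = 0})"
    by (simp add: sum.If_cases Int_def)
  finally show ?thesis
    using sel by (simp add: sum_subtractf sf_selection_def)
qed

text \<open>The entries of \<open>xt\<close> have total mass \<open>T - K\<close>, so the shift,
  weighted by \<open>1 / (T - K)\<close>, raises the mean return by exactly \<alpha>.\<close>

lemma sf_selection_shifted_return:
  assumes sel: "sf_selection n T K r \<mu>0 x xt z" and "K < T"
    and a: "\<And>j t. j \<in> {1..n} \<Longrightarrow> t \<in> {1..T} \<Longrightarrow> a j t = 1 / real (T - K) * (r j t + \<alpha>)"
  shows "\<mu>0 + \<alpha> \<le> (\<Sum>t=1..T. \<Sum>j=1..n. a j t * xt j t)"
proof -
  have "(\<Sum>t=1..T. \<Sum>j=1..n. xt j t) = (\<Sum>t=1..T. 1 - z t)"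
    using sel by (intro sum.cong) (auto simp: sf_selection_def)
  also have "\<dots> = real (T - K)"
    using sel \<open>K < T\<close> by (simp add: sum_subtractf sf_selection_def)
  finally have total: "(\<Sum>t=1..T. \<Sum>j=1..n. xt j t) = real (T - K)" .
  have "(\<Sum>t=1..T. \<Sum>j=1..n. a j t * xt j t) =
      (\<Sum>t=1..T. \<Sum>j=1..n. sf_weight T K t * r j t * xt j t + \<alpha> / real (T - K) * xt j t)"
    by (intro sum.cong refl) (simp add: a sf_weight_def algebra_simps add_divide_distrib)
  also have "\<dots> = sf_mean n T K r xt + \<alpha> / real (T - K) * (\<Sum>t=1..T. \<Sum>j=1..n. xt j t)"
    by (simp add: sf_mean_def sum.distrib sum_distrib_left)
  also have "\<dots> = sf_mean n T K r xt + \<alpha>"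
    unfolding total using \<open>K < T\<close> by simp
  finally show ?thesis
    using sel by (simp add: sf_selection_def)
qed

lemma sf_selection_sum_ge:
  assumes sel: "sf_selection n T K r \<mu>0 x xt z" and "K < T"
    and a: "\<And>j t. j \<in> {1..n} \<Longrightarrow> t \<in> {1..T} \<Longrightarrow> a j t = 1 / real (T - K) * (r j t + \<alpha>)"
    and pos: "\<And>j t. j \<in> {1..n} \<Longrightarrow> t \<in> {1..T} \<Longrightarrow> 0 \<le> a j t"
  shows "\<mu>0 + \<alpha> \<le> (\<Sum>t\<in>{t \<in> {1..T}. z t = 0}. \<Sum>j=1..n. a j t)"
proof -
  let ?P = "{t \<in> {1..T}. z t = 0}"
  have "\<mu>0 + \<alpha> \<le> (\<Sum>t=1..T. \<Sum>j=1..n. a j t * xt j t)"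
    using sf_selection_shifted_return[OF sel \<open>K < T\<close> a] .
  also have "\<dots> = (\<Sum>t\<in>?P. \<Sum>j=1..n. a j t * xt j t)"
    by (intro sum.mono_neutral_right) (auto intro!: sum.neutral simp: sf_selection_eq_zero[OF sel])
  \<comment> \<open>Replacing \<open>xt j t \<le> 1\<close> by 1 can only increase the sum because
    \<open>a j t\<close> is nonnegative.\<close>
  also have "\<dots> \<le> (\<Sum>t\<in>?P. \<Sum>j=1..n. a j t)"
    by (intro sum_mono mult_left_le) (auto simp: pos sf_selection_le_one[OF sel])
  finally show ?thesis .
qed

theorem corollary4:
  fixes n T K :: nat
    and r a :: "nat \<Rightarrow> nat \<Rightarrow> real"
    and \<mu>0 \<alpha> \<beta> :: real
    and Mp Mm :: "nat \<Rightarrow> real"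
    and S :: "nat set"
  assumes "n \<ge> 1" and "T \<ge> 1" and "K < T"
    and "\<alpha> \<ge> 0"
    and "\<And>j t. j \<in> {1..n} \<Longrightarrow> t \<in> {1..T} \<Longrightarrow> a j t = 1 / real (T - K) * (r j t + \<alpha>)"
    and "\<And>j t. j \<in> {1..n} \<Longrightarrow> t \<in> {1..T} \<Longrightarrow> a j t > 0"
    and "\<beta> = \<mu>0 + \<alpha>" and "\<beta> > 0"
    and "sf_big_M n T K r \<mu>0 Mp Mm"
    and "critical n T K a \<beta> S"
  shows "\<forall>x xt z d. sf_feasible n T K r \<mu>0 Mp Mm x xt z d \<longrightarrow>
           (\<forall>j\<in>{1..n}. (\<Sum>t\<in>S. xt j t) \<le> real T - real K - 1)"
proof (intro allI impI ballI)
  fix x xt z d j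
  assume "sf_feasible n T K r \<mu>0 Mp Mm x xt z d" and j: "j \<in> {1..n}"
  then have sel: "sf_selection n T K r \<mu>0 x xt z"
    by (simp add: sf_feasible_def)
  define P where "P = {t \<in> {1..T}. z t = 0}"
  have "finite P"
    by (simp add: P_def)
  have card_P: "real (card P) = real T - real K"
    unfolding P_def by (rule sf_selection_card[OF sel])
  have S: "S \<subseteq> {1..T}"
    using assms(10) by (simp add: critical_def)
  then have "finite S"
    using finite_subset by blast
  have "\<beta> \<le> (\<Sum>t\<in>P. \<Sum>j=1..n. a j t)"
    unfolding P_def assms(7)
    using sf_selection_sum_ge[OF sel assms(3,5)] assms(6) by (simp add: less_imp_le)
  moreover have "card P = T - K"
    using card_P assms(3) by linarith
  \<comment> \<open>If \<open>P\<close> were inside \<open>S\<close>, it could serve as the set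
    \<open>R\<close> in the definition of \<open>critical\<close>, forcing its sum below
    \<beta>.\<close>
  ultimately have "\<not> P \<subseteq> S"
    using assms(10) unfolding critical_def by (meson not_less)
  then have "card (S \<inter> P) < card P"
    using \<open>finite P\<close> by (intro psubset_card_mono) auto
  \<comment> \<open>Cardinalities are integers, so the strict inequality yields the
    \<open>- 1\<close> of the bound.\<close>
  then have card_SP: "real (card (S \<inter> P)) \<le> real T - real K - 1"
    using card_P by linarith
  have "(\<Sum>t\<in>S. xt j t) = (\<Sum>t\<in>S \<inter> P. xt j t)"
    using S j \<open>finite S\<close>
    by (intro sum.mono_neutral_right) (auto simp: P_def intro!: sf_selection_eq_zero[OF sel])
  \<comment> \<open>Only scenarios in \<open>S \<inter> P\<close> remain, each contributing at most
    1.\<close>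
  also have "\<dots> \<le> real (card (S \<inter> P)) * 1"
    using j by (intro sum_bounded_above) (auto simp: P_def intro!: sf_selection_le_one[OF sel])
  finally show "(\<Sum>t\<in>S. xt j t) \<le> real T - real K - 1"
    using card_SP by simp
qed

end
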